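(* Let $\mathcal{T}_0\in\mathcal{G}$ be a (non-empty) appropriate tree and let $j\in\mathbb{N}$ be such that $w(\mathcal{T}_0)<m_j$. Then there exist an $S_{f_j}$-admissible subset $\mathcal{G}_0$ of $\mathcal{G}$ and scalars $(\lambda_{\mathcal{T}})_{\mathcal{T}\in\mathcal{G}_0}$ in $[-1,1]$ such that: (1) $\mu_{\mathcal{T}_0}=\sum_{\mathcal{T}\in\mathcal{G}_0}\lambda_{\mathcal{T}}\,\mu_{\mathcal{T}}$. (2) For each $\mathcal{T}\in\mathcal{G}_0$ at least one of the following holds: either $w(\mathcal{T})=1$ (thus $\mu_{\mathcal{T}}=\pm e_k^*$ for some $k\in\mathbb{N}$), or $w(\mathcal{T})\ge m_j$, or $|\lambda_{\mathcal{T}}|\le\frac{1}{m_j^2}$.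
   Context: Standing data: $M=(m_i)$, $L=(l_i)$ are infinite subsets of $\mathbb{N}$ (enumerated increasingly) with $m_1>6$, $m_i^2<m_{i+1}$, $l_1>4$, $2^{l_i}>m_i$ for all $i$; $N=(n_i)$ is an infinite subset of $\mathbb{N}$ which is $M$-good, i.e. $l_j(f_j+1)<n_j$ for all $j$, where $f_1=1$ and $f_j=\max\{\sum_{i<j}\rho_in_i:\rho_i\in\mathbb{N}\cup\{0\},\ \prod_{i<j}m_i^{\rho_i}<m_j^3\}$ for $j\ge2$. Schreier families: $S_0=\{\{n\}:n\in\mathbb{N}\}\cup\{\emptyset\}$ and, for $\xi<\omega$, $S_{\xi+1}=\{\bigcup_{i=1}^n F_i: n\in\mathbb{N},\ n\le\min F_1,\ F_1<\cdots<F_n,\ F_i\in S_\xi\ (i\le n)\}\cup\{\emptyset\}$, where $E<F$ means $\max E<\min F$. A finite family of finite non-empty subsets of $\mathbb{N}$ is $S_\xi$-admissible if it can be enumerated as $I_1<\cdots<I_n$ with $\{\min I_k:k\le n\}\in S_\xi$. Appropriate trees: let $\mathcal{D}$ be the set of tuples $(t_1,\dots,t_{3n})$, $n\in\mathbb{N}$, with $t_{3i-2}\in M$ for $i<n$, $t_{3n-2}=0$, $t_{3i-1}$ a finite non-empty subset of $\mathbb{N}$ and $t_{3i}\in\{-1,1\}$ for $i\le n$. For a finite non-empty $F_0\subset\mathcal{D}$, $\mathcal{T}_{F_0}$ is the set of all (non-empty) tuples of length divisible by $3$ which are initial segments of elements of $F_0$, partially ordered by initial segment inclusion; it is a finite tree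 whose terminal nodes are exactly the members of $F_0$. The last three entries of $\alpha\in\mathcal{T}_{F_0}$ are denoted $m_\alpha,I_\alpha,\epsilon_\alpha$. A tree $\mathcal{T}=\mathcal{T}_{F_0}$ with a unique root is appropriate if: (i) for $\alpha$ terminal, $I_\alpha=\{p_\alpha\}$ for some $p_\alpha\in\mathbb{N}$; (ii) for $\alpha$ non-terminal with $m_\alpha=m_j$, the family $(I_\beta)_{\beta\in D_\alpha}$ is $S_{n_j}$-admissible and $I_\alpha=\bigcup_{\beta\in D_\alpha}I_\beta$, where $D_\alpha$ is the set of immediate successors of $\alpha$ in $\mathcal{T}$. $\mathcal{G}$ is the set of all appropriate trees (the empty tree is also included by convention). For a node $\alpha$, $\alpha^-$ is its predecessor ($\alpha^-=\emptyset$ for the root); $m(\alpha)=\prod_{m_i\in\alpha^-}m_i$, the product over all entries of $\alpha^-$ belonging to $M$, with multiplicity ($m(\alpha)=1$ for the root); $\epsilon(\alpha)=\prod_{\beta<\alpha}\epsilon_\beta$ ($=1$ for the root). Put $\mu_{\mathcal{T}}=\sum_{\alpha\text{ terminal in }\mathcal{T}}m(\alpha)^{-1}\epsilon(\alpha)\epsilon_\alpha e^*_{p_\alpha}$, where $e_n^*$ is the point mass at $n$, and $\mu_\emptyset=0$. For $\mathcal{T}$ with root $\alpha_0$: $w(\mathcal{T})=1$ if $\mathcal{T}$ has exactly one node, and $w(\mathcal{T})=m_{\alpha_0}$ if $m_{\alpha_0}\in M$. A finite set of trees in $\mathcal{G}$ with roots $\alpha_1,\dots,\alpha_n$ is $S_\xi$-admissible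 if the family $I_{\alpha_1},\dots,I_{\alpha_n}$ is. *)

theory Defs
  imports Complex_Main "HOL-Library.Infinite_Set" "HOL-Library.Sublist"
begin

text \<open>
  The natural numbers of the mathematical text start at 1; the type \<open>nat\<close> includes 0, so
  positivity is stated explicitly throughout.
\<close>

text \<open>The \<open>i\<close>-th element of an infinite set in increasing order, counted from \<open>i = 1\<close>.\<close>

definition elt :: "nat set \<Rightarrow> nat \<Rightarrow> nat" where
  "elt A i = enumerate A (i - 1)"

text \<open>
  The set under the maximum is finite as soon as all members of \<open>M\<close> are at least 2; only the
  values \<open>\<rho> i\<close> for \<open>1 \<le> i < j\<close> matter.
\<close>

definition f_seq :: "nat set \<Rightarrow> nat set \<Rightarrow> nat \<Rightarrow> nat" where
  "f_seq M N j =
    (if j = 1 then 1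
     else Max {\<Sum>i\<in>{1..<j}. \<rho> i * elt N i | \<rho> :: nat \<Rightarrow> nat.
                 (\<Prod>i\<in>{1..<j}. elt M i ^ \<rho> i) < elt M j ^ 3})"

definition M_good :: "nat set \<Rightarrow> nat set \<Rightarrow> nat set \<Rightarrow> bool" where
  "M_good M L N \<longleftrightarrow> (\<forall>j\<ge>1. elt L j * (f_seq M N j + 1) < elt N j)"

definition standing_data :: "nat set \<Rightarrow> nat set \<Rightarrow> nat set \<Rightarrow> bool" where
  "standing_data M L N \<longleftrightarrow>
     infinite M \<and> 0 \<notin> M \<and> infinite L \<and> 0 \<notin> L \<and> infinite N \<and> 0 \<notin> N \<and>
     elt M 1 > 6 \<and> (\<forall>i\<ge>1. (elt M i)\<^sup>2 < elt M (i + 1)) \<and>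
     elt L 1 > 4 \<and> (\<forall>i\<ge>1. 2 ^ elt L i > elt M i) \<and>
     M_good M L N"


subsection \<open>Schreier families and admissibility\<close>

text \<open>Only meaningful for finite non-empty sets.\<close>

definition set_less :: "nat set \<Rightarrow> nat set \<Rightarrow> bool" where
  "set_less E F \<longleftrightarrow> Max E < Min F"

primrec Schreier :: "nat \<Rightarrow> nat set set" where
  "Schreier 0 = {{n} | n. n \<ge> 1} \<union> {{}}"
| "Schreier (Suc \<xi>) =
     {\<Union>(set Fs) | Fs. Fs \<noteq> [] \<and> (\<forall>F\<in>set Fs. F \<noteq> {} \<and> F \<in> Schreier \<xi>) \<and>
        length Fs \<le> Min (hd Fs) \<and> sorted_wrt set_less Fs} \<union> {{}}"

text \<open>
  Admissibility of the indexed family \<open>(I a)\<close>, \<open>a \<in> A\<close>; the list enumerates the index set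
  without repetition (in particular \<open>A\<close> is finite).
\<close>

definition S_admissible :: "nat \<Rightarrow> ('a \<Rightarrow> nat set) \<Rightarrow> 'a set \<Rightarrow> bool" where
  "S_admissible \<xi> I A \<longleftrightarrow>
     (\<forall>a\<in>A. finite (I a) \<and> I a \<noteq> {} \<and> 0 \<notin> I a) \<and>
     (\<exists>xs. distinct xs \<and> set xs = A \<and> sorted_wrt (\<lambda>a b. set_less (I a) (I b)) xs \<and>
           {Min (I a) | a. a \<in> set xs} \<in> Schreier \<xi>)"


subsection \<open>Appropriate trees\<close>

text \<open>
  A tuple \<open>(t\<^sub>1, \<dots>, t\<^sub>3\<^sub>n)\<close> is encoded as the list of its \<open>n\<close> consecutive triples
  \<open>(t\<^sub>3\<^sub>i\<^sub>-\<^sub>2, t\<^sub>3\<^sub>i\<^sub>-\<^sub>1, t\<^sub>3\<^sub>i)\<close>; initial segments of length divisible by 3 are then exactly the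
  prefixes of this list.
\<close>

type_synonym node = "(nat \<times> nat set \<times> int) list"

definition m_of :: "node \<Rightarrow> nat" where
  "m_of \<alpha> = fst (last \<alpha>)"

definition I_of :: "node \<Rightarrow> nat set" where
  "I_of \<alpha> = fst (snd (last \<alpha>))"

definition eps_of :: "node \<Rightarrow> int" where
  "eps_of \<alpha> = snd (snd (last \<alpha>))"

definition D_tuples :: "nat set \<Rightarrow> node set" where
  "D_tuples M = {t. t \<noteq> [] \<and> (\<forall>x\<in>set (butlast t). fst x \<in> M) \<and> fst (last t) = 0 \<and>
     (\<forall>(_, I, \<epsilon>)\<in>set t. finite I \<and> I \<noteq> {} \<and> 0 \<notin> I \<and> \<epsilon> \<in> {-1, 1})}"

definition tree_of :: "node set \<Rightarrow> node set" where
  "tree_of F0 = {\<beta>. \<beta> \<noteq> [] \<and> (\<exists>\<alpha>\<in>F0. prefix \<beta> \<alpha>)}"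

definition is_root :: "node set \<Rightarrow> node \<Rightarrow> bool" where
  "is_root T \<alpha> \<longleftrightarrow> \<alpha> \<in> T \<and> \<not> (\<exists>\<beta>\<in>T. strict_prefix \<beta> \<alpha>)"

definition root_of :: "node set \<Rightarrow> node" where
  "root_of T = (THE \<alpha>. is_root T \<alpha>)"

definition terminal :: "node set \<Rightarrow> node \<Rightarrow> bool" where
  "terminal T \<alpha> \<longleftrightarrow> \<alpha> \<in> T \<and> \<not> (\<exists>\<beta>\<in>T. strict_prefix \<alpha> \<beta>)"

definition succs :: "node set \<Rightarrow> node \<Rightarrow> node set" where
  "succs T \<alpha> = {\<beta>\<in>T. strict_prefix \<alpha> \<beta> \<and>
                     \<not> (\<exists>\<gamma>\<in>T. strict_prefix \<alpha> \<gamma> \<and> strict_prefix \<gamma> \<beta>)}"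

definition appropriate :: "nat set \<Rightarrow> nat set \<Rightarrow> node set \<Rightarrow> bool" where
  "appropriate M N T \<longleftrightarrow>
     (\<exists>F0. finite F0 \<and> F0 \<noteq> {} \<and> F0 \<subseteq> D_tuples M \<and> T = tree_of F0) \<and>
     (\<exists>!\<alpha>. is_root T \<alpha>) \<and>
     (\<forall>\<alpha>. terminal T \<alpha> \<longrightarrow> (\<exists>p\<ge>1. I_of \<alpha> = {p})) \<and>
     (\<forall>\<alpha>\<in>T. \<forall>j\<ge>1. \<not> terminal T \<alpha> \<and> m_of \<alpha> = elt M j \<longrightarrow>
        S_admissible (elt N j) I_of (succs T \<alpha>) \<and>
        I_of \<alpha> = (\<Union>\<beta>\<in>succs T \<alpha>. I_of \<beta>))"

definition G_trees :: "nat set \<Rightarrow> nat set \<Rightarrow> node set set" where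
  "G_trees M N = {T. appropriate M N T} \<union> {{}}"

text \<open>The predecessor \<open>\<alpha>\<^sup>-\<close> of a node \<open>\<alpha>\<close> is \<open>butlast \<alpha>\<close>.\<close>

definition m_prod :: "nat set \<Rightarrow> node \<Rightarrow> nat" where
  "m_prod M \<alpha> = prod_list (filter (\<lambda>x. x \<in> M) (map fst (butlast \<alpha>)))"

definition eps_prod :: "node set \<Rightarrow> node \<Rightarrow> int" where
  "eps_prod T \<alpha> = (\<Prod>\<beta> | \<beta> \<in> T \<and> strict_prefix \<beta> \<alpha>. eps_of \<beta>)"

text \<open>Finitely supported signed measures on the positive integers are identified with their
  densities \<open>nat \<Rightarrow> real\<close>.\<close>

definition e_star :: "nat \<Rightarrow> nat \<Rightarrow> real" where
  "e_star n = (\<lambda>k. if k = n then 1 else 0)"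

definition mu :: "nat set \<Rightarrow> node set \<Rightarrow> nat \<Rightarrow> real" where
  "mu M T = (\<lambda>k. \<Sum>\<alpha> | terminal T \<alpha>.
      inverse (real (m_prod M \<alpha>)) * of_int (eps_prod T \<alpha>) * of_int (eps_of \<alpha>) *
      e_star (the_elem (I_of \<alpha>)) k)"

text \<open>
  An appropriate tree with more than one node has a non-terminal root, whose first entry
  therefore lies in \<open>M\<close>. The value at the empty tree is irrelevant.
\<close>

definition weight :: "node set \<Rightarrow> nat" where
  "weight T = (if card T = 1 then 1 else m_of (root_of T))"

text \<open>Admissibility refers to roots, so the empty tree is excluded.\<close>

definition trees_admissible :: "nat \<Rightarrow> node set set \<Rightarrow> bool" where
  "trees_admissible \<xi> \<G> \<longleftrightarrow> {} \<notin> \<G> \<and> S_admissible \<xi> (\<lambda>T. I_of (root_of T)) \<G>"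

end

theory Submission
  imports Defs
begin

text \<open>
  Descend from the root of \<open>T0\<close> and stop at a node as soon as it is terminal, its weight is at
  least \<open>m\<^sub>j\<close>, or the product \<open>Q\<close> of the weights above it is at least \<open>m\<^sub>j\<^sup>2\<close>. The trees hanging at
  the stopping nodes form the required family, the coefficient being \<open>\<plusminus>1/Q\<close>. Each step of the
  descent multiplies \<open>Q < m\<^sub>j\<^sup>2\<close> by some \<open>m\<^sub>i < m\<^sub>j\<close>, so \<open>Q < m\<^sub>j\<^sup>3\<close> throughout; it composes the
  admissibility level with \<open>S\<^bsub>n\<^sub>i\<^esub>\<close>, and these levels add up to at most \<open>f\<^sub>j\<close>.
\<close>

subsection \<open>Schreier families\<close>

lemma Schreier_finite: "F \<in> Schreier n \<Longrightarrow> finite F \<and> 0 \<notin> F"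
proof (induction n arbitrary: F)
  case (Suc n)
  then show ?case by fastforce
qed auto

text \<open>A one-piece decomposition \<open>[F]\<close> suffices: members are positive, so
  \<open>1 \<le> Min F\<close>.\<close>

lemma Schreier_Suc: "F \<in> Schreier n \<Longrightarrow> F \<in> Schreier (Suc n)"
proof (cases "F = {}")
  case False
  assume F: "F \<in> Schreier n"
  then have "finite F" "0 \<notin> F" using Schreier_finite by auto
  with False have "Min F \<noteq> 0" by (metis Min_in)
  with F False show ?thesis
    by (auto intro!: exI[of _ "[F]"])
qed simp

lemma Schreier_mono: "n \<le> k \<Longrightarrow> Schreier n \<subseteq> Schreier k"
  by (rule lift_Suc_mono_le) (use Schreier_Suc in blast)

section \<open>Composition of Schreier families\<close>

lemma Min_UN_eq:
  fixes E :: "nat \<Rightarrow> nat set"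
  assumes "finite F" "F \<noteq> {}" "\<And>a. a \<in> F \<Longrightarrow> finite (E a) \<and> E a \<noteq> {} \<and> Min (E a) = a"
  shows "Min (\<Union>(E ` F)) = Min F"
proof (rule Min_eqI)
  show "finite (\<Union>(E ` F))" using assms by auto
  have "Min F \<in> F" using assms by simp
  then have "Min F \<in> E (Min F)" using assms(3) by (metis Min_in)
  then show "Min F \<in> \<Union>(E ` F)" using \<open>Min F \<in> F\<close> by blast
next
  fix e assume "e \<in> \<Union>(E ` F)"
  then obtain a where "a \<in> F" "e \<in> E a" by blast
  then have "a \<le> e" using assms(3) Min_le by metis
  moreover have "Min F \<le> a" using \<open>a \<in> F\<close> assms by simp
  ultimately show "Min F \<le> e" by simp
qed

text \<open>Replacing each point by a block that starts at that point adds the levels. In the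
  induction on \<open>n\<close>, every piece \<open>G\<close> of \<open>F\<close> is fattened to the
  union of its blocks. The number of pieces and their minima do not change, so the bound on the
  number of pieces survives, and the third assumption keeps the fattened pieces in order.\<close>

lemma Schreier_UN:
  assumes "F \<in> Schreier n"
    and "\<And>a. a \<in> F \<Longrightarrow> E a \<in> Schreier k \<and> E a \<noteq> {} \<and> Min (E a) = a"
    and "\<And>a b. a \<in> F \<Longrightarrow> b \<in> F \<Longrightarrow> a < b \<Longrightarrow> Max (E a) < b"
  shows "\<Union>(E ` F) \<in> Schreier (n + k)"
  using assms
proof (induction n arbitrary: F)
  case 0
  then consider "F = {}" | a where "F = {a}" by auto
  then show ?case
  proof cases
    case 1
    then show ?thesis by (induction k) auto
  next
    case 2
    then show ?thesis using 0(2) by simp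
  qed
next
  case (Suc n)
  show ?case
  proof (cases "F = {}")
    case False
    then obtain Fs where Fs: "F = \<Union>(set Fs)" "Fs \<noteq> []" "\<And>G. G \<in> set Fs \<Longrightarrow> G \<noteq> {} \<and> G \<in> Schreier n"
      "length Fs \<le> Min (hd Fs)" "sorted_wrt set_less Fs"
      using Suc.prems(1) by auto
    define U where "U G = \<Union>(E ` G)" for G
    have E: "finite (E a) \<and> E a \<noteq> {} \<and> Min (E a) = a" if "a \<in> F" for a
      using Suc.prems(2)[OF that] Schreier_finite by blast
    have sub: "G \<subseteq> F" if "G \<in> set Fs" for G using that Fs(1) by blast
    have finG: "finite G" if "G \<in> set Fs" for G using that Fs(3) Schreier_finite by blast
    have MinU: "Min (U G) = Min G" if "G \<in> set Fs" for G
      unfolding U_def using that Fs(3) finG sub E by (intro Min_UN_eq) blast+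
    have U: "U G \<noteq> {} \<and> U G \<in> Schreier (n + k)" if "G \<in> set Fs" for G
    proof
      show "U G \<noteq> {}" using that Fs(3) E sub unfolding U_def by fastforce
      show "U G \<in> Schreier (n + k)" unfolding U_def
        using that Fs(3) sub Suc.prems(2,3) by (intro Suc.IH) blast+
    qed
    have less: "set_less (U G) (U H)" if "G \<in> set Fs" "H \<in> set Fs" "set_less G H" for G H
    proof -
      have "U G \<noteq> {}" "finite (U G)" using U[OF that(1)] Schreier_finite by blast+
      then have "Max (U G) \<in> U G" by simp
      then obtain a where a: "a \<in> G" "Max (U G) \<in> E a" unfolding U_def by blast
      have H: "Min H \<in> H" using that(2) Fs(3) finG by simp
      have "a \<le> Max G" using a finG that by simp
      then have "a < Min H" using that(3) unfolding set_less_def by simp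
      then have "Max (E a) < Min H" using Suc.prems(3) a H sub that by blast
      moreover have "Max (U G) \<le> Max (E a)" using a E sub that by (metis Max_ge subsetD)
      ultimately show ?thesis using MinU[OF that(2)] unfolding set_less_def by simp
    qed
    have "sorted_wrt set_less (map U Fs)"
      unfolding sorted_wrt_map using Fs(5) by (rule sorted_wrt_mono_rel[rotated]) (rule less)
    moreover have "length (map U Fs) \<le> Min (hd (map U Fs))"
      using Fs(2,4) MinU by (simp add: hd_map)
    moreover have "\<Union>(E ` F) = \<Union>(set (map U Fs))" unfolding U_def Fs(1) by auto
    moreover have "map U Fs \<noteq> []" "\<forall>G\<in>set (map U Fs). G \<noteq> {} \<and> G \<in> Schreier (n + k)"
      using Fs(2) U by auto
    ultimately show ?thesis unfolding add_Suc Schreier.simps by blast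
  qed simp
qed

section \<open>Admissible indexed families\<close>

lemma set_less_imp_Min_less:
  "finite A \<Longrightarrow> A \<noteq> {} \<Longrightarrow> set_less A B \<Longrightarrow> Min A < Min B"
  unfolding set_less_def using Max_ge Min_in le_less_trans by metis

text \<open>Removes the enumerating list from admissibility. For finite non-empty sets
  \<open>set_less\<close> forces the same order on the minima, so pairwise comparable sets have
  distinct minima, and sorting the indices by these minima recovers the enumeration.\<close>

lemma S_admissible_iff:
  "S_admissible n I A \<longleftrightarrow>
     finite A \<and> (\<forall>a\<in>A. finite (I a) \<and> I a \<noteq> {} \<and> 0 \<notin> I a) \<and>
     (\<forall>a\<in>A. \<forall>b\<in>A. a \<noteq> b \<longrightarrow> set_less (I a) (I b) \<or> set_less (I b) (I a)) \<and>
     (\<lambda>a. Min (I a)) ` A \<in> Schreier n"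
  (is "_ \<longleftrightarrow> ?R")
proof
  assume "S_admissible n I A"
  then obtain xs where I: "\<forall>a\<in>A. finite (I a) \<and> I a \<noteq> {} \<and> 0 \<notin> I a"
    and xs: "distinct xs" "set xs = A" "sorted_wrt (\<lambda>a b. set_less (I a) (I b)) xs"
    "{Min (I a) | a. a \<in> set xs} \<in> Schreier n"
    unfolding S_admissible_def by blast
  have "set_less (I a) (I b) \<or> set_less (I b) (I a)" if "a \<in> A" "b \<in> A" "a \<noteq> b" for a b
    using that xs(2,3) unfolding sorted_wrt_iff_nth_less
    by (metis in_set_conv_nth linorder_neqE_nat)
  moreover have "(\<lambda>a. Min (I a)) ` A = {Min (I a) | a. a \<in> set xs}" using xs(2) by blast
  moreover have "finite A" using xs(2) by blast
  ultimately show ?R using I xs(4) by simp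
next
  assume R: ?R
  define key where "key a = Min (I a)" for a
  have less: "key a < key b" if "a \<in> A" "set_less (I a) (I b)" for a b
    using R that set_less_imp_Min_less unfolding key_def by blast
  have total: "set_less (I a) (I b) \<or> set_less (I b) (I a)" if "a \<in> A" "b \<in> A" "a \<noteq> b" for a b
    using R that by blast
  have neq: "set_less (I a) (I b)" if "a \<in> A" "b \<in> A" "key a < key b" for a b
    using that less total by (metis less_asym)
  have inj: "inj_on key A"
    using less total unfolding inj_on_def by (metis less_irrefl)
  \<comment> \<open>\<open>key\<close> is injective on \<open>A\<close>, so the sorted list of
    minima can be pulled back to a list of indices.\<close>
  define xs where "xs = map (the_inv_into A key) (sorted_list_of_set (key ` A))"
  have fin: "finite A" using R by blast
  have set: "set xs = A" using fin the_inv_into_onto[OF inj] unfolding xs_def by simp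
  have dist: "distinct xs" unfolding xs_def distinct_map
    using fin inj_on_the_inv_into[OF inj] by simp
  have "sorted_wrt (\<lambda>a b. set_less (I a) (I b)) xs"
    unfolding xs_def sorted_wrt_map
  proof (rule sorted_wrt_mono_rel[rotated])
    show "sorted_wrt (<) (sorted_list_of_set (key ` A))" by simp
  next
    fix u v assume "u \<in> set (sorted_list_of_set (key ` A))" "v \<in> set (sorted_list_of_set (key ` A))" "u < v"
    then obtain a b where "a \<in> A" "b \<in> A" "u = key a" "v = key b" using fin by auto
    then show "set_less (I (the_inv_into A key u)) (I (the_inv_into A key v))"
      using neq \<open>u < v\<close> by (auto simp: the_inv_into_f_f[OF inj])
  qed
  moreover have "{Min (I a) | a. a \<in> set xs} = (\<lambda>a. Min (I a)) ` A" using set by blast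
  ultimately show "S_admissible n I A"
    unfolding S_admissible_def using R set dist by (intro conjI exI[of _ xs]) simp_all
qed

text \<open>Serves to reindex successor families: by last triples instead of nodes, or after the
  first triple of every node has been dropped.\<close>

lemma S_admissible_image:
  assumes "S_admissible n I (g ` A)" and inj: "inj_on g A" and IJ: "\<And>a. a \<in> A \<Longrightarrow> I (g a) = J a"
  shows "S_admissible n J A"
proof -
  have R: "finite (g ` A)" "\<forall>a\<in>A. finite (I (g a)) \<and> I (g a) \<noteq> {} \<and> 0 \<notin> I (g a)"
    "\<forall>a\<in>A. \<forall>b\<in>A. g a \<noteq> g b \<longrightarrow> set_less (I (g a)) (I (g b)) \<or> set_less (I (g b)) (I (g a))"
    "(\<lambda>a. Min (I a)) ` g ` A \<in> Schreier n"
    using assms(1) unfolding S_admissible_iff by blast+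
  have "(\<lambda>a. Min (J a)) ` A = (\<lambda>a. Min (I a)) ` g ` A" by (simp add: image_image IJ)
  then show ?thesis
    unfolding S_admissible_iff using R IJ finite_imageD[OF R(1) inj] inj_onD[OF inj] by metis
qed

lemma S_admissible_mono: "S_admissible n I A \<Longrightarrow> n \<le> k \<Longrightarrow> S_admissible k I A"
  unfolding S_admissible_iff using Schreier_mono by blast

lemma S_admissible_singleton:
  assumes "finite (I a)" "I a \<noteq> {}" "0 \<notin> I a"
  shows "S_admissible n I {a}"
proof (rule S_admissible_mono)
  have "Min (I a) \<noteq> 0" using assms by (metis Min_in)
  then show "S_admissible 0 I {a}" unfolding S_admissible_iff using assms by auto
qed simp

lemma S_admissible_disjoint:
  assumes "S_admissible n I A" "a \<in> A" "b \<in> A" "a \<noteq> b"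
  shows "I a \<inter> I b = {}"
proof -
  have fin: "finite (I c)" if "c \<in> A" for c using assms(1) that unfolding S_admissible_iff by blast
  have "I c \<inter> I d = {}" if cd: "c \<in> A" "d \<in> A" "set_less (I c) (I d)" for c d
  proof (rule ccontr)
    assume "I c \<inter> I d \<noteq> {}"
    then obtain e where "e \<in> I c" "e \<in> I d" by blast
    then have "e \<le> Max (I c)" "Min (I d) \<le> e" using fin cd by simp_all
    then show False using cd(3) unfolding set_less_def by simp
  qed
  then show ?thesis using assms unfolding S_admissible_iff by (metis Int_commute)
qed

text \<open>The composition step of the descent. Since the sets \<open>J b\<close> with
  \<open>b \<in> B a\<close> fill \<open>I a\<close>, their minima form a block in
  \<open>Schreier k\<close> that lies in \<open>I a\<close> and starts at \<open>Min (I a)\<close>.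
  Attaching these blocks to the minima of the sets \<open>I a\<close> is the situation of
  \<open>Schreier_UN\<close>.\<close>

lemma S_admissible_UN:
  assumes A: "S_admissible n I A"
    and B: "\<And>a. a \<in> A \<Longrightarrow> S_admissible k J (B a)"
    and J: "\<And>a. a \<in> A \<Longrightarrow> (\<Union>b\<in>B a. J b) = I a"
  shows "S_admissible (n + k) J (\<Union>a\<in>A. B a)"
proof -
  \<comment> \<open>\<open>Schreier_UN\<close> wants blocks indexed by their first point, so
    \<open>E\<close> takes a minimum as its argument. Exactly one \<open>a \<in> A\<close> has a
    given minimum, by \<open>same\<close> below.\<close>
  define E where "E m = (\<lambda>b. Min (J b)) ` (\<Union>a\<in>{a \<in> A. Min (I a) = m}. B a)" for m
  have A1: "finite A" "(\<lambda>a. Min (I a)) ` A \<in> Schreier n"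
    using A unfolding S_admissible_iff by blast+
  have A2: "finite (I a)" "I a \<noteq> {}" if "a \<in> A" for a
    using A that unfolding S_admissible_iff by blast+
  have A3: "set_less (I a) (I b) \<or> set_less (I b) (I a)" if "a \<in> A" "b \<in> A" "a \<noteq> b" for a b
    using A that unfolding S_admissible_iff by blast
  have B1: "finite (B a)" "(\<lambda>b. Min (J b)) ` B a \<in> Schreier k" if "a \<in> A" for a
    using B[OF that] unfolding S_admissible_iff by blast+
  have B2: "finite (J b)" "J b \<noteq> {}" "0 \<notin> J b" if "a \<in> A" "b \<in> B a" for a b
    using B[OF that(1)] that(2) unfolding S_admissible_iff by blast+
  have sub: "J b \<subseteq> I a" if "a \<in> A" "b \<in> B a" for a b using J that by blast
  have MinJ: "Min (J b) \<in> I a" if "a \<in> A" "b \<in> B a" for a b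
    using sub B2 that Min_in by blast
  have same: "a = a'" if "a \<in> A" "a' \<in> A" "Min (I a) = Min (I a')" for a a'
    using A3 that A2 set_less_imp_Min_less by (metis less_irrefl)
  have E: "E (Min (I a)) = (\<lambda>b. Min (J b)) ` B a" if "a \<in> A" for a
  proof -
    have "{a' \<in> A. Min (I a') = Min (I a)} = {a}" using that same by blast
    then show ?thesis unfolding E_def by simp
  qed
  have EI: "E (Min (I a)) \<subseteq> I a" "E (Min (I a)) \<noteq> {}" "Min (E (Min (I a))) = Min (I a)"
    if aA: "a \<in> A" for a
  proof -
    show 1: "E (Min (I a)) \<subseteq> I a" using E[OF aA] MinJ aA by auto
    \<comment> \<open>The point \<open>Min (I a)\<close> is covered by some \<open>J b\<close>, and
      as \<open>J b \<subseteq> I a\<close> it must be the minimum of that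
      \<open>J b\<close>.\<close>
    have "Min (I a) \<in> I a" using A2 aA by simp
    then obtain b where b: "b \<in> B a" "Min (I a) \<in> J b" using J[OF aA] by blast
    then show "E (Min (I a)) \<noteq> {}" using E[OF aA] by auto
    have "Min (J b) \<le> Min (I a)" using b B2 aA by simp
    moreover have "Min (I a) \<le> Min (J b)" using MinJ[OF aA b(1)] A2 aA by simp
    ultimately have "Min (I a) \<in> E (Min (I a))" using E[OF aA] b by force
    moreover have "finite (E (Min (I a)))" using 1 A2 aA finite_subset by blast
    ultimately show "Min (E (Min (I a))) = Min (I a)"
      using 1 A2 aA by (intro Min_eqI) auto
  qed
  have "\<Union>(E ` ((\<lambda>a. Min (I a)) ` A)) \<in> Schreier (n + k)"
  proof (rule Schreier_UN[OF A1(2)])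
    fix m assume "m \<in> (\<lambda>a. Min (I a)) ` A"
    then show "E m \<in> Schreier k \<and> E m \<noteq> {} \<and> Min (E m) = m" using EI E B1 by auto
  next
    fix m m' assume "m \<in> (\<lambda>a. Min (I a)) ` A" "m' \<in> (\<lambda>a. Min (I a)) ` A" "m < m'"
    then obtain a a' where a: "a \<in> A" "a' \<in> A" "m = Min (I a)" "m' = Min (I a')" by blast
    with \<open>m < m'\<close> have "set_less (I a) (I a')"
      using A3 A2 set_less_imp_Min_less by (metis less_asym)
    moreover have "Max (E m) \<le> Max (I a)" using EI a A2 by (simp add: Max_mono)
    ultimately show "Max (E m) < m'" using a unfolding set_less_def by simp
  qed
  moreover have "\<Union>(E ` ((\<lambda>a. Min (I a)) ` A)) = (\<lambda>b. Min (J b)) ` (\<Union>a\<in>A. B a)"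
    using E by (auto simp: image_iff)
  moreover have "set_less (J b) (J b') \<or> set_less (J b') (J b)"
    if b: "a \<in> A" "b \<in> B a" "a' \<in> A" "b' \<in> B a'" "b \<noteq> b'" for a b a' b'
  proof -
    have less: "set_less (J c) (J c')"
      if c: "d \<in> A" "c \<in> B d" "d' \<in> A" "c' \<in> B d'" "set_less (I d) (I d')" for c c' d d'
    proof -
      have "Max (J c) \<le> Max (I d)" using sub[OF c(1,2)] A2 B2 c by (intro Max_mono) blast+
      moreover have "Min (I d') \<le> Min (J c')" using sub[OF c(3,4)] A2 B2 c by (intro Min_antimono) blast+
      ultimately show ?thesis using c(5) unfolding set_less_def by simp
    qed
    show ?thesis
    proof (cases "a = a'")
      case True
      then show ?thesis using B[OF b(1)] b unfolding S_admissible_iff by blast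
    next
      case False
      then show ?thesis using A3 b less by blast
    qed
  qed
  ultimately show ?thesis unfolding S_admissible_iff using A1 B1 B2 by auto
qed

subsection \<open>The level budget\<close>

text \<open>For \<open>j > 1\<close> and \<open>Q = 1\<close> this is the set maximised in
  \<open>f_seq\<close>. In general a factor \<open>Q\<close> of the allowance
  \<open>elt M j ^ 3\<close> is already spent.\<close>

definition levels :: "nat set \<Rightarrow> nat set \<Rightarrow> nat \<Rightarrow> nat \<Rightarrow> nat set" where
  "levels M N j Q = {\<Sum>i\<in>{1..<j}. \<rho> i * elt N i | \<rho> :: nat \<Rightarrow> nat.
     Q * (\<Prod>i\<in>{1..<j}. elt M i ^ \<rho> i) < elt M j ^ 3}"

text \<open>The admissibility level still available below a node with weight product \<open>Q\<close>.\<close>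

definition budget :: "nat set \<Rightarrow> nat set \<Rightarrow> nat \<Rightarrow> nat \<Rightarrow> nat" where
  "budget M N j Q = Max (levels M N j Q)"

text \<open>Each exponent is below the allowance:
  \<open>\<rho> i \<le> 2 ^ \<rho> i \<le> elt M i ^ \<rho> i\<close>, and this power divides a
  non-zero product that stays below \<open>elt M j ^ 3\<close>.\<close>

lemma finite_levels:
  assumes M: "\<And>i. i \<ge> 1 \<Longrightarrow> elt M i \<ge> 2" and "Q \<ge> 1"
  shows "finite (levels M N j Q)"
proof -
  have "(\<Sum>i\<in>{1..<j}. \<rho> i * elt N i) \<le> (\<Sum>i\<in>{1..<j}. elt M j ^ 3 * elt N i)"
    if \<rho>: "Q * (\<Prod>i\<in>{1..<j}. elt M i ^ \<rho> i) < elt M j ^ 3" for \<rho>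
  proof (intro sum_mono mult_right_mono)
    fix i assume i: "i \<in> {1..<j}"
    have "\<rho> i \<le> 2 ^ \<rho> i" using less_exp less_imp_le by blast
    also have "\<dots> \<le> elt M i ^ \<rho> i" using M i by (intro power_mono) auto
    also have "\<dots> \<le> (\<Prod>i\<in>{1..<j}. elt M i ^ \<rho> i)"
    proof -
      have "elt M k ^ \<rho> k \<noteq> 0" if "k \<in> {1..<j}" for k using M[of k] that by simp
      then have "(\<Prod>i\<in>{1..<j}. elt M i ^ \<rho> i) \<noteq> 0" by simp
      moreover have "elt M i ^ \<rho> i dvd (\<Prod>i\<in>{1..<j}. elt M i ^ \<rho> i)"
        using i by (intro dvd_prodI) auto
      ultimately show ?thesis by (simp add: dvd_imp_le)
    qed
    also have "\<dots> \<le> Q * (\<Prod>i\<in>{1..<j}. elt M i ^ \<rho> i)" using \<open>Q \<ge> 1\<close> by simp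
    finally show "\<rho> i \<le> elt M j ^ 3" using \<rho> by simp
  qed simp
  then show ?thesis unfolding finite_nat_set_iff_bounded_le levels_def by blast
qed

text \<open>Exponents that attain the maximum for \<open>Q * elt M i\<close> become admissible for
  \<open>Q\<close> once the \<open>i\<close>-th is raised by one: the factor \<open>elt M i\<close>
  moves from \<open>Q\<close> into the product, and the sum gains \<open>elt N i\<close>.\<close>

lemma budget_step:
  assumes M: "\<And>i. i \<ge> 1 \<Longrightarrow> elt M i \<ge> 2" and "Q \<ge> 1"
    and i: "1 \<le> i" "i < j" and Q: "Q * elt M i < elt M j ^ 3"
  shows "elt N i + budget M N j (Q * elt M i) \<le> budget M N j Q"
proof -
  have Qi: "1 \<le> Q * elt M i" using M[OF i(1)] \<open>Q \<ge> 1\<close> by simp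
  \<comment> \<open>Zero exponents are allowed by the bound on \<open>Q * elt M i\<close>, so the
    set is non-empty and its maximum is attained.\<close>
  have "0 \<in> levels M N j (Q * elt M i)"
    unfolding levels_def using Q by (auto intro!: exI[of _ "\<lambda>_. 0"])
  then have "budget M N j (Q * elt M i) \<in> levels M N j (Q * elt M i)"
    unfolding budget_def using finite_levels[OF M Qi] by (intro Max_in) auto
  then obtain \<rho> where \<rho>: "budget M N j (Q * elt M i) = (\<Sum>i\<in>{1..<j}. \<rho> i * elt N i)"
    "Q * elt M i * (\<Prod>i\<in>{1..<j}. elt M i ^ \<rho> i) < elt M j ^ 3"
    unfolding levels_def by blast
  define \<sigma> where "\<sigma> = \<rho>(i := Suc (\<rho> i))"
  have mem: "i \<in> {1..<j}" using i by simp
  have s: "(\<Sum>k\<in>{1..<j}. \<sigma> k * elt N k) = elt N i + (\<Sum>k\<in>{1..<j}. \<rho> k * elt N k)"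
    unfolding sum.remove[OF finite_atLeastLessThan mem] \<sigma>_def by simp
  have p: "(\<Prod>k\<in>{1..<j}. elt M k ^ \<sigma> k) = elt M i * (\<Prod>k\<in>{1..<j}. elt M k ^ \<rho> k)"
    unfolding prod.remove[OF finite_atLeastLessThan mem] \<sigma>_def by simp
  have "elt N i + budget M N j (Q * elt M i) \<in> levels M N j Q"
    unfolding levels_def using s p \<rho> by (auto intro!: exI[of _ \<sigma>] simp: mult.assoc)
  then show ?thesis unfolding budget_def[of M N j Q]
    using finite_levels[OF M \<open>Q \<ge> 1\<close>] by (intro Max_ge)
qed

text \<open>For \<open>j \<noteq> 1\<close> both sides are the same maximum. For
  \<open>j = 1\<close> the only level is the empty sum 0, while \<open>f_seq\<close> has the value
  1.\<close>

lemma budget_le_f_seq: "elt M j \<ge> 2 \<Longrightarrow> budget M N j 1 \<le> f_seq M N j"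
proof (cases "j = 1")
  case True
  assume "elt M j \<ge> 2"
  then have "1 < elt M j ^ 3" by (intro one_less_power) auto
  then have "levels M N j 1 = {0}" unfolding levels_def using True by simp
  then show ?thesis unfolding budget_def f_seq_def using True by simp
qed (simp add: budget_def levels_def f_seq_def)

subsection \<open>Branches of a tree\<close>

text \<open>Keeps only the shape of a tree and names the root by its single triple \<open>x\<close>.
  The subtree below a child is again an instance, which is what the recursion needs.\<close>

locale rooted_tree =
  fixes T :: "node set" and x :: "nat \<times> nat set \<times> int"
  assumes finite_T: "finite T"
    and root_mem: "[x] \<in> T"
    and mem_Cons: "\<gamma> \<in> T \<Longrightarrow> \<exists>\<delta>. \<gamma> = x # \<delta>"
    and prefix_closed: "\<gamma> \<in> T \<Longrightarrow> prefix \<delta> \<gamma> \<Longrightarrow> \<delta> \<noteq> [] \<Longrightarrow> \<delta> \<in> T"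
begin

lemma is_root_iff: "is_root T \<gamma> \<longleftrightarrow> \<gamma> = [x]"
proof
  assume r: "is_root T \<gamma>"
  then obtain \<delta> where \<delta>: "\<gamma> = x # \<delta>" using mem_Cons unfolding is_root_def by blast
  then have "\<not> strict_prefix [x] \<gamma>" using r root_mem unfolding is_root_def by blast
  then show "\<gamma> = [x]" using \<delta> by (auto simp: strict_prefix_def)
next
  assume "\<gamma> = [x]"
  then show "is_root T \<gamma>" unfolding is_root_def
    using root_mem mem_Cons by (fastforce simp: strict_prefix_def)
qed

lemma root_of_eq: "root_of T = [x]"
  unfolding root_of_def is_root_iff by simp

lemma terminal_root_iff: "terminal T [x] \<longleftrightarrow> T = {[x]}"
proof
  assume "terminal T [x]"
  then show "T = {[x]}" using mem_Cons root_mem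
    unfolding terminal_def strict_prefix_def by fastforce
qed (simp add: terminal_def)

lemma weight_eq: "T \<noteq> {[x]} \<Longrightarrow> weight T = fst x"
  using root_mem unfolding weight_def root_of_eq m_of_def by (auto simp: card_1_singleton_iff)

definition children :: "(nat \<times> nat set \<times> int) set" where
  "children = {y. [x, y] \<in> T}"

text \<open>Dropping the leading \<open>x\<close> turns the subtree below \<open>[x, y]\<close> into
  a tree with root \<open>[y]\<close>, whose products of weights and signs no longer contain the
  contribution of \<open>x\<close>.\<close>

definition branch :: "nat \<times> nat set \<times> int \<Rightarrow> node set" where
  "branch y = {\<gamma>. prefix [y] \<gamma> \<and> x # \<gamma> \<in> T}"

lemma finite_children: "finite children"
proof -
  have "(\<lambda>y. [x, y]) ` children \<subseteq> T" unfolding children_def by blast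
  moreover have "inj_on (\<lambda>y. [x, y]) children" by (simp add: inj_on_def)
  ultimately show ?thesis using finite_T finite_imageD finite_subset by metis
qed

lemma succs_root: "succs T [x] = (\<lambda>y. [x, y]) ` children"
proof
  show "(\<lambda>y. [x, y]) ` children \<subseteq> succs T [x]"
    unfolding succs_def children_def
    by (auto simp: strict_prefix_def prefix_Cons Cons_eq_append_conv prefix_def append_eq_Cons_conv)
  show "succs T [x] \<subseteq> (\<lambda>y. [x, y]) ` children"
  proof
    fix \<gamma> assume g: "\<gamma> \<in> succs T [x]"
    then have gT: "\<gamma> \<in> T" "strict_prefix [x] \<gamma>" unfolding succs_def by auto
    then obtain y \<delta> where d: "\<gamma> = x # y # \<delta>"
      by (metis append_Cons append_Nil neq_Nil_conv prefix_def strict_prefix_def append_Nil2)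
    then have "[x, y] \<in> T" using gT prefix_closed by (auto simp: prefix_def)
    moreover from this g d have "\<not> strict_prefix [x, y] \<gamma>"
      unfolding succs_def by (auto simp: strict_prefix_def)
    ultimately show "\<gamma> \<in> (\<lambda>y. [x, y]) ` children"
      unfolding children_def d by (auto simp: strict_prefix_def)
  qed
qed

text \<open>Prepending \<open>x\<close> embeds the branch into \<open>T\<close> and misses the root.
  This is the decrease that drives the main induction.\<close>

lemma card_branch_less: "card (branch y) < card T"
proof -
  have "(#) x ` branch y \<subset> T" using root_mem unfolding branch_def by (auto simp: prefix_def)
  then have "card ((#) x ` branch y) < card T" using finite_T psubset_card_mono by blast
  then show ?thesis by (simp add: card_image)
qed

lemma rooted_branch:
  assumes "y \<in> children"
  shows "rooted_tree (branch y) y"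
proof
  have "(#) x ` branch y \<subseteq> T" unfolding branch_def by blast
  then show "finite (branch y)" using finite_T finite_imageD finite_subset by (metis inj_on_Cons1)
  show "[y] \<in> branch y" using assms unfolding branch_def children_def by simp
  show "\<exists>\<delta>. \<gamma> = y # \<delta>" if "\<gamma> \<in> branch y" for \<gamma>
    using that unfolding branch_def by (auto simp: prefix_def)
  show "\<delta> \<in> branch y" if "\<gamma> \<in> branch y" "prefix \<delta> \<gamma>" "\<delta> \<noteq> []" for \<gamma> \<delta>
    using that prefix_closed[of "x # \<gamma>" "x # \<delta>"] unfolding branch_def
    by (auto simp: prefix_def Cons_eq_append_conv append_eq_Cons_conv)
qed

lemma terminal_branch:
  "prefix [y] \<delta> \<Longrightarrow> terminal (branch y) \<delta> \<longleftrightarrow> terminal T (x # \<delta>)"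
proof -
  assume y: "prefix [y] \<delta>"
  have "(\<exists>\<gamma>\<in>T. strict_prefix (x # \<delta>) \<gamma>) \<longleftrightarrow> (\<exists>\<gamma>\<in>branch y. strict_prefix \<delta> \<gamma>)"
  proof
    assume "\<exists>\<gamma>\<in>T. strict_prefix (x # \<delta>) \<gamma>"
    then obtain \<gamma> where "x # \<gamma> \<in> T" "strict_prefix (x # \<delta>) (x # \<gamma>)" using mem_Cons by metis
    moreover from this have "strict_prefix \<delta> \<gamma>" by (simp add: strict_prefix_def)
    ultimately show "\<exists>\<gamma>\<in>branch y. strict_prefix \<delta> \<gamma>"
      using y unfolding branch_def by (auto simp: strict_prefix_def intro: prefix_order.trans)
  next
    assume "\<exists>\<gamma>\<in>branch y. strict_prefix \<delta> \<gamma>"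
    then obtain \<gamma> where "x # \<gamma> \<in> T" "strict_prefix \<delta> \<gamma>" unfolding branch_def by blast
    moreover from this have "strict_prefix (x # \<delta>) (x # \<gamma>)" by (simp add: strict_prefix_def)
    ultimately show "\<exists>\<gamma>\<in>T. strict_prefix (x # \<delta>) \<gamma>" by blast
  qed
  then show ?thesis using y unfolding terminal_def by (auto simp: branch_def)
qed

lemma succs_branch:
  assumes y: "prefix [y] \<delta>"
  shows "succs T (x # \<delta>) = (#) x ` succs (branch y) \<delta>"
proof -
  have mem: "x # \<gamma> \<in> T \<longleftrightarrow> \<gamma> \<in> branch y" if "strict_prefix \<delta> \<gamma>" for \<gamma>
    using that y unfolding branch_def by (auto simp: strict_prefix_def intro: prefix_order.trans)
  have sp: "strict_prefix (x # \<beta>) (x # \<gamma>) \<longleftrightarrow> strict_prefix \<beta> \<gamma>" for \<beta> \<gamma>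
    by (auto simp: strict_prefix_def)
  have "x # \<gamma> \<in> succs T (x # \<delta>) \<longleftrightarrow> \<gamma> \<in> succs (branch y) \<delta>" for \<gamma>
    unfolding succs_def using mem sp mem_Cons by (smt (verit) mem_Collect_eq)
  moreover have "\<exists>\<gamma>. \<beta> = x # \<gamma>" if "\<beta> \<in> succs T (x # \<delta>)" for \<beta>
    using that mem_Cons unfolding succs_def by blast
  ultimately show ?thesis by blast
qed

section \<open>The measure of a tree in terms of its branches\<close>

lemma terminal_eq_UN:
  assumes "T \<noteq> {[x]}"
  shows "{\<alpha>. terminal T \<alpha>} = (\<Union>y\<in>children. (#) x ` {\<delta>. terminal (branch y) \<delta>})"
proof (intro equalityI subsetI)
  fix \<alpha> assume "\<alpha> \<in> {\<alpha>. terminal T \<alpha>}"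
  then have a: "terminal T \<alpha>" "\<alpha> \<in> T" unfolding terminal_def by auto
  moreover have "\<alpha> \<noteq> [x]" using a assms terminal_root_iff by blast
  ultimately obtain y \<delta> where d: "\<alpha> = x # y # \<delta>" using mem_Cons neq_Nil_conv by metis
  then have "[x, y] \<in> T" using a prefix_closed by (auto simp: prefix_def)
  then show "\<alpha> \<in> (\<Union>y\<in>children. (#) x ` {\<delta>. terminal (branch y) \<delta>})"
    using a d terminal_branch[of y "y # \<delta>"] unfolding children_def
    by (intro UN_I[of y] image_eqI[of _ _ "y # \<delta>"]) auto
next
  fix \<alpha> assume "\<alpha> \<in> (\<Union>y\<in>children. (#) x ` {\<delta>. terminal (branch y) \<delta>})"
  then obtain y \<delta> where "\<alpha> = x # \<delta>" "terminal (branch y) \<delta>" by blast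
  moreover from this have "prefix [y] \<delta>" unfolding terminal_def branch_def by blast
  ultimately show "\<alpha> \<in> {\<alpha>. terminal T \<alpha>}" using terminal_branch by blast
qed

text \<open>The proper predecessors of \<open>x # \<delta>\<close> are the root and the shifted
  proper predecessors of \<open>\<delta>\<close>. A predecessor with non-empty tail stays in the
  same branch because its tail begins with \<open>y\<close> as well.\<close>

lemma eps_prod_branch:
  assumes "\<delta> \<in> branch y"
  shows "eps_prod T (x # \<delta>) = snd (snd x) * eps_prod (branch y) \<delta>"
proof -
  have y: "prefix [y] \<delta>" "x # \<delta> \<in> T" using assms unfolding branch_def by auto
  have pre: "{\<beta>. \<beta> \<in> T \<and> strict_prefix \<beta> (x # \<delta>)} =
      insert [x] ((#) x ` {\<beta>. \<beta> \<in> branch y \<and> strict_prefix \<beta> \<delta>})" (is "?A = ?B")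
  proof (intro equalityI subsetI)
    fix \<beta> assume "\<beta> \<in> ?A"
    then have b: "\<beta> \<in> T" "strict_prefix \<beta> (x # \<delta>)" by auto
    then obtain \<gamma> where g: "\<beta> = x # \<gamma>" using mem_Cons by blast
    then have sp: "strict_prefix \<gamma> \<delta>" using b by (auto simp: strict_prefix_def)
    show "\<beta> \<in> ?B"
    proof (cases \<gamma>)
      case (Cons z \<epsilon>)
      then have "prefix [y] \<gamma>" using sp y by (auto simp: strict_prefix_def prefix_def)
      then show ?thesis using b g sp unfolding branch_def by auto
    qed (use g in simp)
  next
    fix \<beta> assume "\<beta> \<in> ?B"
    then show "\<beta> \<in> ?A" using root_mem y unfolding branch_def
      by (auto simp: strict_prefix_def prefix_def)
  qed
  have "finite {\<beta>. \<beta> \<in> branch y \<and> strict_prefix \<beta> \<delta>}"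
  proof (rule finite_subset)
    show "{\<beta>. \<beta> \<in> branch y \<and> strict_prefix \<beta> \<delta>} \<subseteq> set (prefixes \<delta>)"
      by (auto simp: strict_prefix_def)
  qed simp
  moreover have "[x] \<notin> (#) x ` {\<beta>. \<beta> \<in> branch y \<and> strict_prefix \<beta> \<delta>}"
    unfolding branch_def by auto
  moreover have "(\<Prod>\<beta>\<in>(#) x ` {\<beta>. \<beta> \<in> branch y \<and> strict_prefix \<beta> \<delta>}. eps_of \<beta>) =
      eps_prod (branch y) \<delta>"
    unfolding eps_prod_def
    by (subst prod.reindex) (auto intro!: prod.cong simp: eps_of_def branch_def)
  ultimately show ?thesis unfolding eps_prod_def[of T] pre by (simp add: eps_of_def)
qed

text \<open>Prepending \<open>x\<close> to a terminal node of a branch multiplies its weight product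
  by \<open>fst x\<close> and its sign product by \<open>snd (snd x)\<close>, and leaves its last
  triple unchanged. Summing over the terminal nodes, grouped by branch, gives the identity.\<close>

lemma mu_branches:
  assumes "T \<noteq> {[x]}" and "fst x \<in> M"
  shows "mu M T k = (\<Sum>y\<in>children. of_int (snd (snd x)) / real (fst x) * mu M (branch y) k)"
proof -
  define t where "t U \<alpha> = inverse (real (m_prod M \<alpha>)) * of_int (eps_prod U \<alpha>) * of_int (eps_of \<alpha>) *
      e_star (the_elem (I_of \<alpha>)) k" for U \<alpha>
  have tm: "\<delta> \<in> branch y \<and> \<delta> \<noteq> []" if "terminal (branch y) \<delta>" for y \<delta>
    using that unfolding terminal_def branch_def by auto
  have t: "t T (x # \<delta>) = of_int (snd (snd x)) / real (fst x) * t (branch y) \<delta>"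
    if "terminal (branch y) \<delta>" for y \<delta>
    using tm[OF that] eps_prod_branch[of \<delta> y] assms(2) unfolding t_def
    by (simp add: m_prod_def eps_of_def I_of_def field_simps)
  have fin: "finite {\<delta>. terminal (branch y) \<delta>}" if "y \<in> children" for y
    using rooted_tree.finite_T[OF rooted_branch[OF that]]
    by (rule rev_finite_subset) (auto simp: terminal_def)
  have "mu M T k = (\<Sum>\<alpha>\<in>(\<Union>y\<in>children. (#) x ` {\<delta>. terminal (branch y) \<delta>}). t T \<alpha>)"
    unfolding mu_def t_def terminal_eq_UN[OF assms(1)] ..
  also have "\<dots> = (\<Sum>y\<in>children. \<Sum>\<alpha>\<in>(#) x ` {\<delta>. terminal (branch y) \<delta>}. t T \<alpha>)"
  proof (rule sum.UNION_disjoint)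
    \<comment> \<open>Nodes of different branches differ in their first triple.\<close>
    show "\<forall>y\<in>children. \<forall>z\<in>children. y \<noteq> z \<longrightarrow>
      (#) x ` {\<delta>. terminal (branch y) \<delta>} \<inter> (#) x ` {\<delta>. terminal (branch z) \<delta>} = {}"
      unfolding terminal_def branch_def by (auto simp: prefix_def)
  qed (use finite_children fin in auto)
  also have "\<dots> = (\<Sum>y\<in>children. of_int (snd (snd x)) / real (fst x) * mu M (branch y) k)"
  proof (rule sum.cong)
    fix y
    have "(\<Sum>\<alpha>\<in>(#) x ` {\<delta>. terminal (branch y) \<delta>}. t T \<alpha>) =
      (\<Sum>\<delta> | terminal (branch y) \<delta>. of_int (snd (snd x)) / real (fst x) * t (branch y) \<delta>)"
      by (subst sum.reindex) (auto intro!: sum.cong simp: t)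
    then show "(\<Sum>\<alpha>\<in>(#) x ` {\<delta>. terminal (branch y) \<delta>}. t T \<alpha>) =
      of_int (snd (snd x)) / real (fst x) * mu M (branch y) k"
      unfolding mu_def t_def by (simp add: sum_distrib_left)
  qed simp
  finally show ?thesis .
qed

end

subsection \<open>Appropriate trees\<close>

lemma finite_tree_of: "finite F \<Longrightarrow> finite (tree_of F)"
proof -
  assume "finite F"
  then have "finite (\<Union>\<alpha>\<in>F. set (prefixes \<alpha>))" by simp
  then show ?thesis by (rule rev_finite_subset) (auto simp: tree_of_def)
qed

text \<open>The first triple of any node, taken as a one-element list, is itself a root. Uniqueness
  of the root therefore makes all nodes begin with the same triple.\<close>

lemma appropriate_rooted:
  assumes "appropriate M N T"
  shows "\<exists>x. rooted_tree T x"
proof -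
  obtain F where F: "finite F" "T = tree_of F" using assms unfolding appropriate_def by blast
  have "\<exists>!\<alpha>. is_root T \<alpha>" using assms unfolding appropriate_def by (elim conjE)
  then obtain r where r: "is_root T r" "\<And>\<alpha>. is_root T \<alpha> \<Longrightarrow> \<alpha> = r" by auto
  have pc: "\<delta> \<in> T" if "\<gamma> \<in> T" "prefix \<delta> \<gamma>" "\<delta> \<noteq> []" for \<gamma> \<delta>
  proof -
    obtain \<alpha> where "\<alpha> \<in> F" "prefix \<gamma> \<alpha>" using \<open>\<gamma> \<in> T\<close> unfolding F(2) tree_of_def by blast
    moreover from this have "prefix \<delta> \<alpha>" using that(2) prefix_order.trans by blast
    ultimately show ?thesis using that(3) unfolding F(2) tree_of_def by blast
  qed
  have ne: "\<gamma> \<noteq> []" if "\<gamma> \<in> T" for \<gamma> using that unfolding F(2) tree_of_def by auto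
  have root: "[z] = r" if "z # \<delta> \<in> T" for z \<delta>
  proof (rule r(2))
    have "[z] \<in> T" using pc[OF that] by simp
    then show "is_root T [z]" unfolding is_root_def using ne by (auto simp: strict_prefix_def prefix_Cons)
  qed
  have "r \<in> T" using r(1) unfolding is_root_def by blast
  then obtain z \<delta> where z: "r = z # \<delta>" using ne neq_Nil_conv by metis
  then have rz: "r = [z]" using root \<open>r \<in> T\<close> by metis
  have "rooted_tree T z"
  proof
    show "finite T" unfolding F(2) by (rule finite_tree_of[OF F(1)])
    show "[z] \<in> T" using rz \<open>r \<in> T\<close> by simp
    show "\<exists>\<delta>. \<gamma> = z # \<delta>" if "\<gamma> \<in> T" for \<gamma>
      using ne[OF that] that root rz by (cases \<gamma>) auto
  qed (rule pc)
  then show ?thesis ..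
qed

lemma (in rooted_tree) appropriate_root_entry:
  assumes "appropriate M N T"
  shows "finite (I_of [x])" "I_of [x] \<noteq> {}" "0 \<notin> I_of [x]" "snd (snd x) \<in> {-1, 1}"
    "T \<noteq> {[x]} \<Longrightarrow> fst x \<in> M"
proof -
  obtain F where F: "F \<subseteq> D_tuples M" "T = tree_of F" using assms unfolding appropriate_def by blast
  have mem: "\<exists>\<delta>. x # \<gamma> @ \<delta> \<in> F" if "x # \<gamma> \<in> T" for \<gamma>
    using that unfolding F(2) tree_of_def by (auto simp: prefix_def)
  obtain \<delta> where "x # \<delta> \<in> F" using mem root_mem by force
  then have D: "x # \<delta> \<in> D_tuples M" using F by blast
  then show "finite (I_of [x])" "I_of [x] \<noteq> {}" "0 \<notin> I_of [x]" "snd (snd x) \<in> {-1, 1}"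
    unfolding D_tuples_def I_of_def by (auto split: prod.splits)
  \<comment> \<open>A longer node extends to a generating tuple in which \<open>x\<close> is not the
    last triple, and all triples but the last have their first entry in \<open>M\<close>.\<close>
  assume "T \<noteq> {[x]}"
  then obtain \<gamma> where "x # \<gamma> \<in> T" "\<gamma> \<noteq> []" using root_mem mem_Cons by blast
  then obtain \<delta>' where "x # \<gamma> @ \<delta>' \<in> D_tuples M" using mem F by blast
  then show "fst x \<in> M" using \<open>\<gamma> \<noteq> []\<close> unfolding D_tuples_def by auto
qed

text \<open>The branch is generated by the tails of those generating tuples that continue
  \<open>x\<close> with \<open>y\<close>. Both local conditions concern only last triples,
  terminality and successors, which prepending \<open>x\<close> preserves.\<close>

lemma (in rooted_tree) appropriate_branch:
  assumes T: "appropriate M N T" and y: "y \<in> children"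
  shows "appropriate M N (branch y)"
proof -
  obtain F where F: "finite F" "F \<subseteq> D_tuples M" "T = tree_of F"
    using T unfolding appropriate_def by blast
  define F' where "F' = {\<delta>. prefix [y] \<delta> \<and> x # \<delta> \<in> F}"
  interpret b: rooted_tree "branch y" y by (rule rooted_branch[OF y])
  have bF: "branch y = tree_of F'"
  proof (intro equalityI subsetI)
    fix \<gamma> assume "\<gamma> \<in> branch y"
    then have g: "prefix [y] \<gamma>" "x # \<gamma> \<in> T" unfolding branch_def by auto
    then obtain \<delta> where "x # \<gamma> @ \<delta> \<in> F" unfolding F(3) tree_of_def by (auto simp: prefix_def)
    then have "\<gamma> @ \<delta> \<in> F'" unfolding F'_def using g(1) by (auto simp: prefix_def)
    moreover have "prefix \<gamma> (\<gamma> @ \<delta>)" "\<gamma> \<noteq> []" using g(1) by auto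
    ultimately show "\<gamma> \<in> tree_of F'" unfolding tree_of_def by blast
  next
    fix \<gamma> assume "\<gamma> \<in> tree_of F'"
    then obtain \<delta> where d: "\<gamma> \<noteq> []" "prefix \<gamma> \<delta>" "prefix [y] \<delta>" "x # \<delta> \<in> F"
      unfolding tree_of_def F'_def by auto
    then have "prefix [y] \<gamma>" by (cases \<gamma>) (auto simp: prefix_def)
    moreover have "prefix (x # \<gamma>) (x # \<delta>)" using d by simp
    then have "x # \<gamma> \<in> T" unfolding F(3) tree_of_def using d by blast
    ultimately show "\<gamma> \<in> branch y" unfolding branch_def by blast
  qed
  have "(#) x ` F' \<subseteq> F" unfolding F'_def by blast
  then have "finite F'" using F(1) finite_imageD finite_subset by (metis inj_on_Cons1)
  moreover have "F' \<noteq> {}" using b.root_mem unfolding bF tree_of_def by blast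
  moreover have "F' \<subseteq> D_tuples M"
  proof
    fix \<delta> assume "\<delta> \<in> F'"
    then have "x # \<delta> \<in> D_tuples M" "\<delta> \<noteq> []" using F(2) unfolding F'_def by auto
    \<comment> \<open>As \<open>\<delta>\<close> is non-empty, removing \<open>x\<close> leaves the
      last triple in place and only shortens the list of non-last ones.\<close>
    then show "\<delta> \<in> D_tuples M" unfolding D_tuples_def by auto
  qed
  ultimately have 1: "\<exists>F0. finite F0 \<and> F0 \<noteq> {} \<and> F0 \<subseteq> D_tuples M \<and> branch y = tree_of F0"
    using bF by blast
  have 2: "\<exists>!\<alpha>. is_root (branch y) \<alpha>" unfolding b.is_root_iff by simp
  have pre: "prefix [y] \<delta>" "\<delta> \<noteq> []" "x # \<delta> \<in> T" if "\<delta> \<in> branch y" for \<delta>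
    using that unfolding branch_def by auto
  have last: "I_of (x # \<delta>) = I_of \<delta>" "m_of (x # \<delta>) = m_of \<delta>" if "\<delta> \<noteq> []" for \<delta>
    using that by (simp_all add: I_of_def m_of_def)
  have 3: "\<exists>p\<ge>1. I_of \<delta> = {p}" if "terminal (branch y) \<delta>" for \<delta>
  proof -
    have "\<delta> \<in> branch y" using that unfolding terminal_def by blast
    then have "terminal T (x # \<delta>)" "I_of (x # \<delta>) = I_of \<delta>"
      using that terminal_branch pre last by auto
    then show ?thesis using T unfolding appropriate_def by metis
  qed
  have 4: "S_admissible (elt N j) I_of (succs (branch y) \<delta>) \<and>
      I_of \<delta> = (\<Union>\<beta>\<in>succs (branch y) \<delta>. I_of \<beta>)"
    if d: "\<delta> \<in> branch y" and j: "j \<ge> 1" "\<not> terminal (branch y) \<delta>" "m_of \<delta> = elt M j" for \<delta> j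
  proof -
    let ?S = "succs (branch y) \<delta>"
    have "\<not> terminal T (x # \<delta>)" "m_of (x # \<delta>) = elt M j"
      using terminal_branch pre[OF d] last j by auto
    then have A: "S_admissible (elt N j) I_of (succs T (x # \<delta>))"
      "I_of (x # \<delta>) = (\<Union>\<beta>\<in>succs T (x # \<delta>). I_of \<beta>)"
      using T j(1) pre[OF d] unfolding appropriate_def by blast+
    have s: "succs T (x # \<delta>) = (#) x ` ?S" by (rule succs_branch) (rule pre[OF d])
    have I: "I_of (x # \<beta>) = I_of \<beta>" if "\<beta> \<in> ?S" for \<beta>
    proof -
      have "\<beta> \<in> branch y" using that unfolding succs_def by blast
      then show ?thesis using last pre by blast
    qed
    have "S_admissible (elt N j) I_of ?S"
      by (rule S_admissible_image[OF A(1)[unfolded s]]) (simp_all add: I)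
    moreover have "I_of \<delta> = (\<Union>\<beta>\<in>?S. I_of \<beta>)"
      using A(2) I last(1)[OF pre(2)[OF d]] unfolding s by simp
    ultimately show ?thesis ..
  qed
  show ?thesis unfolding appropriate_def
    by (intro conjI allI ballI impI 1 2) (use 3 4 in blast)+
qed

text \<open>Condition (ii) at the root, reindexed from successor nodes \<open>[x, y]\<close> to
  triples \<open>y\<close>.\<close>

lemma (in rooted_tree) appropriate_children:
  assumes T: "appropriate M N T" and nt: "T \<noteq> {[x]}" and i: "i \<ge> 1" "fst x = elt M i"
  shows "S_admissible (elt N i) (\<lambda>y. I_of [y]) children" "I_of [x] = (\<Union>y\<in>children. I_of [y])"
proof -
  have I: "I_of [x, y] = I_of [y]" for y by (simp add: I_of_def)
  have "\<not> terminal T [x]" "m_of [x] = elt M i" using nt i terminal_root_iff by (auto simp: m_of_def)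
  then have A: "S_admissible (elt N i) I_of (succs T [x])" "I_of [x] = (\<Union>\<beta>\<in>succs T [x]. I_of \<beta>)"
    using T i(1) root_mem unfolding appropriate_def by blast+
  show "I_of [x] = (\<Union>y\<in>children. I_of [y])" using A(2) unfolding succs_root by (simp add: I)
  show "S_admissible (elt N i) (\<lambda>y. I_of [y]) children"
    by (rule S_admissible_image[OF A(1)[unfolded succs_root]]) (simp_all add: I inj_on_def)
qed

text \<open>The root is the only terminal node and has no predecessors, so both products are empty
  and the sign of \<open>x\<close> alone remains.\<close>

lemma (in rooted_tree) mu_singleton:
  assumes "appropriate M N T" "T = {[x]}"
  shows "\<exists>k\<ge>1. \<exists>s\<in>{-1, 1}. mu M T = (\<lambda>i. s * e_star k i)"
proof -
  have "terminal T [x]" using assms(2) terminal_root_iff by blast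
  then obtain p where p: "p \<ge> 1" "I_of [x] = {p}" using assms(1) unfolding appropriate_def by blast
  have "{\<alpha>. terminal T \<alpha>} = {[x]}" using assms(2) unfolding terminal_def by auto
  moreover have "{\<beta>. \<beta> \<in> T \<and> strict_prefix \<beta> [x]} = {}" using assms(2) by auto
  then have "eps_prod T [x] = 1" unfolding eps_prod_def by (simp only: prod.empty)
  ultimately have "mu M T = (\<lambda>i. of_int (snd (snd x)) * e_star p i)"
    unfolding mu_def using p by (simp add: m_prod_def eps_of_def)
  moreover have "real_of_int (snd (snd x)) \<in> {-1, 1}"
    using appropriate_root_entry(4)[OF assms(1)] by auto
  ultimately show ?thesis using p(1) by blast
qed

subsection \<open>The decomposition\<close>

text \<open>The form of the claim that passes through the induction. \<open>Q\<close> stands for the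
  product of the weights above \<open>T\<close>, while \<open>c\<close> is relative to
  \<open>T\<close>; smallness is therefore tested after division by \<open>Q\<close>. The clause
  that the root sets cover \<open>I_of (root_of T)\<close> is what allows admissible families to be
  composed.\<close>

definition is_decomposition ::
  "nat set \<Rightarrow> nat set \<Rightarrow> nat \<Rightarrow> nat \<Rightarrow> node set \<Rightarrow> node set set \<Rightarrow> (node set \<Rightarrow> real) \<Rightarrow> bool" where
  "is_decomposition M N j Q T \<G> c \<longleftrightarrow>
    \<G> \<subseteq> {T. appropriate M N T} \<and>
    S_admissible (budget M N j Q) (\<lambda>T. I_of (root_of T)) \<G> \<and>
    (\<Union>U\<in>\<G>. I_of (root_of U)) = I_of (root_of T) \<and>
    (\<forall>U\<in>\<G>. \<bar>c U\<bar> \<le> 1) \<and>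
    (\<forall>k. mu M T k = (\<Sum>U\<in>\<G>. c U * mu M U k)) \<and>
    (\<forall>U\<in>\<G>.
       (weight U = 1 \<and> (\<exists>k\<ge>1. \<exists>s\<in>{-1, 1}. mu M U = (\<lambda>i. s * e_star k i))) \<or>
       weight U \<ge> elt M j \<or>
       \<bar>c U\<bar> / real Q \<le> 1 / (real (elt M j))\<^sup>2)"

text \<open>Induction on the number of nodes with \<open>Q\<close> arbitrary, since a branch below a
  root of weight \<open>elt M i\<close> is treated with \<open>Q * elt M i\<close>.\<close>

lemma ex_decomposition:
  assumes M: "infinite M" "\<And>i. i \<ge> 1 \<Longrightarrow> elt M i \<ge> 2"
    and "j \<ge> 1" and "Q \<ge> 1" and "appropriate M N T"
  shows "\<exists>\<G> c. is_decomposition M N j Q T \<G> c"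
  using assms(4,5)
proof (induction "card T" arbitrary: T Q rule: less_induct)
  case less
  note T = \<open>appropriate M N T\<close>
  obtain x where "rooted_tree T x" using appropriate_rooted[OF T] by blast
  then interpret rooted_tree T x .
  note root = appropriate_root_entry[OF T]
  have mj: "elt M j \<ge> 2" using M(2) \<open>j \<ge> 1\<close> .
  show ?case
  proof (cases "T = {[x]} \<or> weight T \<ge> elt M j \<or> (elt M j)\<^sup>2 \<le> Q")
    \<comment> \<open>The descent stops: the family is \<open>{T}\<close> with coefficient 1. If the
      product is large, \<open>1 / Q\<close> already satisfies the smallness alternative.\<close>
    case True
    have "S_admissible (budget M N j Q) (\<lambda>T. I_of (root_of T)) {T}"
      using root unfolding root_of_eq[symmetric] by (intro S_admissible_singleton)
    moreover have "(weight T = 1 \<and> (\<exists>k\<ge>1. \<exists>s\<in>{-1, 1}. mu M T = (\<lambda>i. s * e_star k i))) \<or>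
       weight T \<ge> elt M j \<or> \<bar>1\<bar> / real Q \<le> 1 / (real (elt M j))\<^sup>2"
    proof -
      have "\<bar>1\<bar> / real Q \<le> 1 / (real (elt M j))\<^sup>2" if "(elt M j)\<^sup>2 \<le> Q"
      proof -
        have "(real (elt M j))\<^sup>2 \<le> real Q" using that by (metis of_nat_le_iff of_nat_power)
        then show ?thesis using mj by (simp add: frac_le)
      qed
      moreover have "weight T = 1" if "T = {[x]}" unfolding weight_def that by simp
      ultimately show ?thesis using True mu_singleton[OF T] by blast
    qed
    ultimately show ?thesis using T unfolding is_decomposition_def
      by (intro exI[of _ "{T}"] exI[of _ "\<lambda>_. 1"]) simp
  next
    case False
    then have nt: "T \<noteq> {[x]}" and w: "fst x < elt M j" and Q: "Q < (elt M j)\<^sup>2"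
      using weight_eq by auto
    obtain n where "enumerate M n = fst x"
      using root(5)[OF nt] M(1) enumerate_Ex by blast
    \<comment> \<open>\<open>enumerate\<close> counts from 0 and \<open>elt\<close> from 1, so
      \<open>i\<close> is \<open>n + 1\<close>.\<close>
    then obtain i where i: "i \<ge> 1" "fst x = elt M i" by (metis elt_def diff_Suc_1 le_add1 plus_1_eq_Suc)
    have "i - 1 < j - 1" using w M(1) unfolding i(2) elt_def by simp
    then have ij: "i < j" by simp
    define P where "P = Q * elt M i"
    have x2: "fst x \<ge> 2" using M(2) i by simp
    have P1: "P \<ge> 1" unfolding P_def using less.prems(1) M(2)[OF i(1)] by simp
    \<comment> \<open>Before this step the product is below the square and the new factor is below
      \<open>elt M j\<close>; hence the cube in \<open>f_seq\<close>.\<close>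
    have P3: "P < elt M j ^ 3"
      unfolding P_def power3_eq_cube power2_eq_square[symmetric]
      using Q w i(2) by (intro mult_strict_mono) (auto simp flip: power2_eq_square)
    have bud: "elt N i + budget M N j P \<le> budget M N j Q"
      using budget_step[OF M(2) less.prems(1) i(1) ij] P3 unfolding P_def by blast
    note kids = appropriate_children[OF T nt i]
    let ?J = "\<lambda>U. I_of (root_of U)"
    have "\<forall>y\<in>children. \<exists>\<G> c. is_decomposition M N j P (branch y) \<G> c"
      using less.hyps[OF card_branch_less P1 appropriate_branch[OF T]] by blast
    then obtain \<G> c where dec:
      "\<And>y. y \<in> children \<Longrightarrow> is_decomposition M N j P (branch y) (\<G> y) (c y)"
      by metis
    have G: "\<G> y \<subseteq> {T. appropriate M N T}" "S_admissible (budget M N j P) ?J (\<G> y)"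
      "(\<Union>U\<in>\<G> y. ?J U) = I_of [y]"
      and c: "\<And>U. U \<in> \<G> y \<Longrightarrow> \<bar>c y U\<bar> \<le> 1"
      and mu: "\<And>k. mu M (branch y) k = (\<Sum>U\<in>\<G> y. c y U * mu M U k)"
      and alt: "\<And>U. U \<in> \<G> y \<Longrightarrow>
         (weight U = 1 \<and> (\<exists>k\<ge>1. \<exists>s\<in>{-1, 1}. mu M U = (\<lambda>i. s * e_star k i))) \<or>
         weight U \<ge> elt M j \<or> \<bar>c y U\<bar> / real P \<le> 1 / (real (elt M j))\<^sup>2"
      if "y \<in> children" for y
      using dec[OF that] rooted_tree.root_of_eq[OF rooted_branch[OF that]]
      unfolding is_decomposition_def by simp_all
    \<comment> \<open>A common tree would have a non-empty root set inside both
      \<open>I_of [y]\<close> and \<open>I_of [z]\<close>, which are disjoint by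
      admissibility.\<close>
    have disj: "\<G> y \<inter> \<G> z = {}" if "y \<in> children" "z \<in> children" "y \<noteq> z" for y z
    proof (rule ccontr)
      assume "\<G> y \<inter> \<G> z \<noteq> {}"
      then obtain U where U: "U \<in> \<G> y" "U \<in> \<G> z" by blast
      then have "?J U \<subseteq> I_of [y] \<inter> I_of [z]" using G(3) that by blast
      moreover have "?J U \<noteq> {}" using G(2)[OF that(1)] U unfolding S_admissible_iff by blast
      ultimately show False using S_admissible_disjoint[OF kids(1) that] by blast
    qed
    \<comment> \<open>Coefficients must be a function of the tree alone. By disjointness
      \<open>h\<close> recovers the child from which a tree comes.\<close>
    define h where "h U = (SOME y. y \<in> children \<and> U \<in> \<G> y)" for U
    have h: "h U = y" if "y \<in> children" "U \<in> \<G> y" for y U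
      unfolding h_def using that disj by (intro some_equality) blast+
    \<comment> \<open>The common factor of the branches in \<open>mu_branches\<close>; its absolute
      value is the reciprocal of the root weight.\<close>
    define d where "d = of_int (snd (snd x)) / real (fst x)"
    have absd: "\<bar>d\<bar> = 1 / real (fst x)" using root(4) unfolding d_def by auto
    have d1: "\<bar>d\<bar> \<le> 1" using absd x2 by simp
    have fin: "finite (\<G> y)" if "y \<in> children" for y
      using G(2)[OF that] unfolding S_admissible_iff by blast
    show ?thesis
      unfolding is_decomposition_def
    proof (intro exI conjI)
      show "(\<Union>y\<in>children. \<G> y) \<subseteq> {T. appropriate M N T}" using G(1) by blast
      show "S_admissible (budget M N j Q) ?J (\<Union>y\<in>children. \<G> y)"
        \<comment> \<open>The composed level is \<open>elt N i + budget M N j P\<close>, which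
          \<open>bud\<close> bounds by the budget for \<open>Q\<close>.\<close>
        using S_admissible_UN[OF kids(1) G(2,3)] bud by (rule S_admissible_mono)
      show "(\<Union>U\<in>(\<Union>y\<in>children. \<G> y). ?J U) = ?J T"
        unfolding root_of_eq kids(2) using G(3) by blast
      show "\<forall>U\<in>(\<Union>y\<in>children. \<G> y). \<bar>d * c (h U) U\<bar> \<le> 1"
        using c d1 h by (auto simp: abs_mult intro!: mult_le_one)
      show "\<forall>k. mu M T k = (\<Sum>U\<in>(\<Union>y\<in>children. \<G> y). d * c (h U) U * mu M U k)"
      proof
        fix k
        have "(\<Sum>U\<in>(\<Union>y\<in>children. \<G> y). d * c (h U) U * mu M U k) =
            (\<Sum>y\<in>children. \<Sum>U\<in>\<G> y. d * c (h U) U * mu M U k)"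
          using finite_children fin disj by (intro sum.UNION_disjoint) auto
        also have "\<dots> = (\<Sum>y\<in>children. d * mu M (branch y) k)"
          by (intro sum.cong refl) (simp add: mu sum_distrib_left h mult.assoc cong: sum.cong)
        also have "\<dots> = mu M T k" unfolding d_def using mu_branches[OF nt root(5)[OF nt]] by simp
        finally show "mu M T k = (\<Sum>U\<in>(\<Union>y\<in>children. \<G> y). d * c (h U) U * mu M U k)" ..
      qed
      show "\<forall>U\<in>(\<Union>y\<in>children. \<G> y).
        (weight U = 1 \<and> (\<exists>k\<ge>1. \<exists>s\<in>{-1, 1}. mu M U = (\<lambda>i. s * e_star k i))) \<or>
        weight U \<ge> elt M j \<or> \<bar>d * c (h U) U\<bar> / real Q \<le> 1 / (real (elt M j))\<^sup>2"
      proof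
        fix U assume "U \<in> (\<Union>y\<in>children. \<G> y)"
        then obtain y where y: "y \<in> children" "U \<in> \<G> y" by blast
        \<comment> \<open>The factor \<open>1 / elt M i\<close> gained by the coefficient is exactly
          the one by which \<open>P\<close> exceeds \<open>Q\<close>, so the smallness test is the
          same at both levels.\<close>
        have "\<bar>d * c (h U) U\<bar> / real Q = \<bar>c y U\<bar> / real P"
          unfolding h[OF y] abs_mult absd P_def i(2) by simp
        then show "(weight U = 1 \<and> (\<exists>k\<ge>1. \<exists>s\<in>{-1, 1}. mu M U = (\<lambda>i. s * e_star k i))) \<or>
          weight U \<ge> elt M j \<or> \<bar>d * c (h U) U\<bar> / real Q \<le> 1 / (real (elt M j))\<^sup>2"
          using alt[OF y] by simp
      qed
    qed
  qed
qed

theorem lemma4p3: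
  fixes M L N :: "nat set" and T0 :: "node set" and j :: nat
  assumes "standing_data M L N"
    and "T0 \<in> G_trees M N" and "T0 \<noteq> {}"
    and "j \<ge> 1" and "weight T0 < elt M j"
  shows "\<exists>\<G>\<^sub>0 c.
    \<G>\<^sub>0 \<subseteq> G_trees M N \<and> trees_admissible (f_seq M N j) \<G>\<^sub>0 \<and>
    (\<forall>T\<in>\<G>\<^sub>0. c T \<in> {-1..1 :: real}) \<and>
    mu M T0 = (\<lambda>k. \<Sum>T\<in>\<G>\<^sub>0. c T * mu M T k) \<and>
    (\<forall>T\<in>\<G>\<^sub>0.
       (weight T = 1 \<and> (\<exists>k\<ge>1. \<exists>s\<in>{-1, 1}. mu M T = (\<lambda>i. s * e_star k i))) \<or>
       weight T \<ge> elt M j \<or>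
       \<bar>c T\<bar> \<le> 1 / (real (elt M j))\<^sup>2)"
proof -
  have inf: "infinite M" and m1: "elt M 1 > 6" using assms(1) unfolding standing_data_def by blast+
  have m2: "elt M i \<ge> 2" if "i \<ge> 1" for i
  proof -
    have "elt M 1 \<le> elt M i" unfolding elt_def using inf by simp
    then show ?thesis using m1 by simp
  qed
  have T0: "appropriate M N T0" using assms(2,3) unfolding G_trees_def by blast
  \<comment> \<open>Nothing lies above the root of \<open>T0\<close>, so the product starts at the
    empty product 1. Dividing by it leaves the required smallness condition.\<close>
  obtain \<G> c where "is_decomposition M N j 1 T0 \<G> c"
    using ex_decomposition[OF inf m2 assms(4) order_refl T0] by blast
  then have G: "\<G> \<subseteq> {T. appropriate M N T}"
    "S_admissible (budget M N j 1) (\<lambda>T. I_of (root_of T)) \<G>"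
    "\<forall>U\<in>\<G>. \<bar>c U\<bar> \<le> 1"
    "\<forall>k. mu M T0 k = (\<Sum>U\<in>\<G>. c U * mu M U k)"
    "\<forall>U\<in>\<G>.
       (weight U = 1 \<and> (\<exists>k\<ge>1. \<exists>s\<in>{-1, 1}. mu M U = (\<lambda>i. s * e_star k i))) \<or>
       weight U \<ge> elt M j \<or> \<bar>c U\<bar> \<le> 1 / (real (elt M j))\<^sup>2"
    unfolding is_decomposition_def by simp_all
  have "{} \<notin> \<G>" using G(1) appropriate_rooted rooted_tree.root_mem by blast
  moreover have "S_admissible (f_seq M N j) (\<lambda>T. I_of (root_of T)) \<G>"
    using G(2) budget_le_f_seq[OF m2[OF assms(4)]] by (rule S_admissible_mono)
  ultimately show ?thesis using G unfolding trees_admissible_def G_trees_def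
    by (intro exI[of _ \<G>] exI[of _ c]) (auto simp: abs_le_iff)
qed

end
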